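(* Suppose Assumptions (A) and (B) (stated in the context) hold. If $\hat{\boldsymbol\beta}\to\boldsymbol\beta^\star$ in probability, then $P(\mathcal E)\to1$ as $n\to\infty$, where $$\mathcal E=\{\hat\mu_i\ne0\text{ for } i=1,\dots,s_1;\ \text{and } \hat\mu_i=0\text{ for } i=s_1+1,\dots,n\}.$$
   Context: Notation: $a_n\ll b_n$ (equivalently $b_n\gg a_n$) means $a_n=o(b_n)$; all limits are as $n\to\infty$. Model: $d\ge 1$ is a fixed integer. For each $n$ the data satisfy $Y_i=\mu_i^\star+\boldsymbol X_i^T\boldsymbol\beta^\star+\epsilon_i$, $1\le i\le n$, where $\boldsymbol\beta^\star\in\mathbb R^d$ and $\boldsymbol\mu^\star=(\mu_1^\star,\dots,\mu_n^\star)^T$ are deterministic ($\boldsymbol\mu^\star$ may vary with $n$). The $\boldsymbol X_i$ are i.i.d. copies of a random vector $\boldsymbol X_0\in\mathbb R^d$ with mean zero and positive definite covariance matrix $\boldsymbol\Sigma_X$; they are independent of the $\epsilon_i$, which are i.i.d. copies of a random variable $\epsilon_0$ with mean zero and variance $\sigma^2>0$. $\boldsymbol X$ is the $n\times d$ matrix with rows $\boldsymbol X_i^T$ and $\boldsymbol Y=(Y_1,\dots,Y_n)^T$. Assumption (A): there are positive sequences $\kappa_n\ll\sqrt n$, $\gamma_n\ll\sqrt n$ with $P(\max_{1\le i\le n}\|\boldsymbol X_i\|_2>\kappa_n)\to0$ and $P(\max_{1\le i\le n}|\epsilon_i|>\gamma_n)\to0$. Incidental parameters: with $s=s_1+s_2$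 and $s_1+s_2=o(n)$: $|\mu_i^\star|\gg\max\{\kappa_n,\gamma_n\}$ for $1\le i\le s_1$; $0<|\mu_i^\star|\le\gamma_n$ for $s_1+1\le i\le s$; $\mu_i^\star=0$ for $s+1\le i\le n$. Let $\mu^\star=\min_{1\le i\le s_1}|\mu_i^\star|$. Assumption (B): the regularization parameter $\lambda=\lambda_n>0$ satisfies $\kappa_n\ll\lambda$, $\alpha\gamma_n\le\lambda$ for a constant $\alpha>2$, and $\lambda\ll\min\{\mu^\star,\sqrt n\}$. Estimators: $(\hat{\boldsymbol\mu},\hat{\boldsymbol\beta})$ is a minimizer over $\mathbb R^n\times\mathbb R^d$ of $L(\boldsymbol\mu,\boldsymbol\beta)=\|\boldsymbol Y-\boldsymbol\mu-\boldsymbol X\boldsymbol\beta\|_2^2+2\lambda\sum_{i=1}^n|\mu_i|$; in particular $\hat\mu_i=(|Y_i-\boldsymbol X_i^T\hat{\boldsymbol\beta}|-\lambda)_+\,\mathrm{sign}(Y_i-\boldsymbol X_i^T\hat{\boldsymbol\beta})$ for each $i$. *)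

theory Defs
  imports "HOL-Probability.Probability" "HOL-Library.Landau_Symbols"
begin

definition covariance_matrix :: "'a measure \<Rightarrow> ('a \<Rightarrow> real ^ 'd) \<Rightarrow> real ^ 'd ^ 'd" where
  "covariance_matrix M Z =
     (\<chi> i j. \<integral>\<omega>. (Z \<omega> $ i - (\<integral>\<omega>'. Z \<omega>' $ i \<partial>M)) * (Z \<omega> $ j - (\<integral>\<omega>'. Z \<omega>' $ j \<partial>M)) \<partial>M)"

definition positive_definite :: "real ^ 'd ^ 'd \<Rightarrow> bool" where
  "positive_definite A \<longleftrightarrow> transpose A = A \<and> (\<forall>v. v \<noteq> 0 \<longrightarrow> v \<bullet> (A *v v) > 0)"

definition iid_copies ::
  "'a measure \<Rightarrow> (nat \<Rightarrow> 'a \<Rightarrow> 'b :: topological_space) \<Rightarrow> nat set \<Rightarrow> 'c measure \<Rightarrow> ('c \<Rightarrow> 'b) \<Rightarrow> bool" where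
  "iid_copies M Z I M\<^sub>0 Z\<^sub>0 \<longleftrightarrow>
     prob_space.indep_vars M (\<lambda>_. borel) Z I \<and>
     (\<forall>i\<in>I. distr M borel (Z i) = distr M\<^sub>0 borel Z\<^sub>0)"

text \<open>Independence of the family \<open>(Z\<^sub>i)\<close> from the family \<open>(W\<^sub>i)\<close>, i.e. of the two sigma-algebras
  that they generate.  The library's \<^term>\<open>prob_space.indep_var\<close> needs equal value types.\<close>

definition indep_families ::
  "'a measure \<Rightarrow> (nat \<Rightarrow> 'a \<Rightarrow> 'b :: topological_space) \<Rightarrow> (nat \<Rightarrow> 'a \<Rightarrow> 'c :: topological_space) \<Rightarrow>
   nat set \<Rightarrow> bool" where
  "indep_families M Z W I \<longleftrightarrow>
     prob_space.indep_set M
       (sets (vimage_algebra (space M) (\<lambda>\<omega>. \<lambda>i\<in>I. Z i \<omega>) (\<Pi>\<^sub>M i\<in>I. borel)))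
       (sets (vimage_algebra (space M) (\<lambda>\<omega>. \<lambda>i\<in>I. W i \<omega>) (\<Pi>\<^sub>M i\<in>I. borel)))"

text \<open>The \<open>n\<close>-th random variable may live on its own probability space.\<close>

definition converges_in_probability ::
  "(nat \<Rightarrow> 'a measure) \<Rightarrow> (nat \<Rightarrow> 'a \<Rightarrow> 'b :: metric_space) \<Rightarrow> 'b \<Rightarrow> bool" where
  "converges_in_probability M Z z \<longleftrightarrow>
     (\<forall>e>0. (\<lambda>n. measure (M n) {\<omega> \<in> space (M n). dist (Z n \<omega>) z > e}) \<longlonglongrightarrow> 0)"

text \<open>Vectors of length \<open>n\<close> are functions on \<^typ>\<open>nat\<close> of which only the values on \<open>{1..n}\<close> are used.
  The first sum is the squared Euclidean norm of the residual vector.\<close>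

definition penalized_loss ::
  "nat \<Rightarrow> real \<Rightarrow> (nat \<Rightarrow> real) \<Rightarrow> (nat \<Rightarrow> real ^ 'd) \<Rightarrow> (nat \<Rightarrow> real) \<times> (real ^ 'd) \<Rightarrow> real" where
  "penalized_loss n lam y x = (\<lambda>(m, b).
     (\<Sum>i=1..n. (y i - m i - x i \<bullet> b)\<^sup>2) + 2 * lam * (\<Sum>i=1..n. \<bar>m i\<bar>))"

text \<open>The minimum of \<open>\<bar>m\<^sub>i\<bar>\<close> over \<open>1 \<le> i \<le> k\<close>, which is infinite if \<open>k = 0\<close>.\<close>

definition min_signal :: "(nat \<Rightarrow> real) \<Rightarrow> nat \<Rightarrow> ereal" where
  "min_signal m k = (INF i\<in>{1..k}. ereal \<bar>m i\<bar>)"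

text \<open>\<open>a\<^sub>n \<lless> \<bar>m\<^sub>n\<^sub>i\<bar>\<close> for \<open>1 \<le> i \<le> k\<^sub>n\<close>.  As the index range varies with \<open>n\<close>, this is required
  uniformly in \<open>i\<close>.\<close>

definition dominated_by_entries ::
  "(nat \<Rightarrow> real) \<Rightarrow> (nat \<Rightarrow> nat \<Rightarrow> real) \<Rightarrow> (nat \<Rightarrow> nat) \<Rightarrow> bool" where
  "dominated_by_entries a m k \<longleftrightarrow>
     (\<forall>c>0. \<forall>\<^sub>F n in sequentially. \<forall>i\<in>{1..k n}. \<bar>a n\<bar> \<le> c * \<bar>m n i\<bar>)"

end

theory Submission
  imports Defs
begin

text \<open>With \<open>\<beta>hat\<close> fixed, the loss separates over the coordinates, so \<open>\<mu>hat\<^sub>i\<close> vanishes exactly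
  when the \<open>i\<close>-th residual \<open>r\<^sub>i = \<mu>\<^sub>i + X\<^sub>i \<bullet> (\<beta> - \<beta>hat) + \<epsilon>\<^sub>i\<close> is at most \<open>lam\<close> in absolute value.
  With probability tending to one, \<open>\<bar>X\<^sub>i\<bar> \<le> \<kappa>\<close> and \<open>\<bar>\<epsilon>\<^sub>i\<bar> \<le> \<gamma>\<close> for all \<open>i\<close> and \<open>\<bar>\<beta>hat - \<beta>\<bar> \<le> 1\<close>.
  Then \<open>\<bar>r\<^sub>i\<bar> \<le> 2 \<gamma> + \<kappa> \<le> lam\<close> for \<open>i > s\<^sub>1\<close>, because \<open>\<gamma> \<le> lam / \<alpha>\<close> with \<open>\<alpha> > 2\<close> and \<open>\<kappa> \<lless> lam\<close>;
  and \<open>\<bar>r\<^sub>i\<bar> \<ge> \<bar>\<mu>\<^sub>i\<bar> - \<kappa> - \<gamma> > lam\<close> for \<open>i \<le> s\<^sub>1\<close>, because \<open>lam \<lless> min \<bar>\<mu>\<^sub>i\<bar>\<close>.\<close>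

text \<open>Only the \<open>i\<close>-th summand of each sum feels the update, so comparing a
  minimizer with its one-entry updates leaves a scalar problem for each entry.\<close>

lemma penalized_loss_fun_upd:
  assumes "i \<in> {1..n}"
  shows "penalized_loss n lam y x (m(i := t), b) =
    penalized_loss n lam y x (m, b) +
      ((y i - x i \<bullet> b - t)\<^sup>2 + 2 * lam * \<bar>t\<bar>) - ((y i - x i \<bullet> b - m i)\<^sup>2 + 2 * lam * \<bar>m i\<bar>)"
proof -
  have upd: "(\<Sum>j=1..n. g j ((m(i := t)) j)) = (\<Sum>j=1..n. g j (m j)) + g i t - g i (m i)"
    for g :: "nat \<Rightarrow> real \<Rightarrow> real"
  proof -
    have "(\<Sum>j\<in>{1..n} - {i}. g j ((m(i := t)) j)) = (\<Sum>j\<in>{1..n} - {i}. g j (m j))"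
      by (intro sum.cong) auto
    then show ?thesis
      using assms sum.remove[of "{1..n}" i "\<lambda>j. g j ((m(i := t)) j)"]
        sum.remove[of "{1..n}" i "\<lambda>j. g j (m j)"] by simp
  qed
  show ?thesis
    unfolding penalized_loss_def prod.case upd[of "\<lambda>j u. (y j - u - x j \<bullet> b)\<^sup>2"]
      upd[of "\<lambda>j. abs"]
    by (simp add: algebra_simps)
qed

text \<open>Two competitors suffice. If \<bar>r\<bar> \<le> lam, the choice \<open>t = 0\<close>
  forces the square of \<open>m\<close> to be at most 0. If \<open>m = 0\<close> and \<bar>r\<bar> >
  lam, the soft-thresholded value \<open>r - lam\<close> or \<open>r + lam\<close> lowers the
  objective by exactly its own square.\<close>

lemma soft_threshold_eq_0_iff:
  fixes r m lam :: real
  assumes lam: "lam > 0"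
    and min: "\<And>t. (r - m)\<^sup>2 + 2 * lam * \<bar>m\<bar> \<le> (r - t)\<^sup>2 + 2 * lam * \<bar>t\<bar>"
  shows "m = 0 \<longleftrightarrow> \<bar>r\<bar> \<le> lam"
proof
  assume "\<bar>r\<bar> \<le> lam"
  then have "r * m \<le> lam * \<bar>m\<bar>"
    by (metis abs_ge_self abs_mult abs_ge_zero mult_right_mono order_trans)
  then have "2 * (r * m - lam * \<bar>m\<bar>) \<le> 0" by simp
  moreover have "m\<^sup>2 \<le> 2 * (r * m - lam * \<bar>m\<bar>)"
    using min[of 0] by (simp add: power2_diff algebra_simps)
  ultimately have "m\<^sup>2 \<le> 0" by (rule order_trans[rotated])
  then show "m = 0" by simp
next
  assume m: "m = 0"
  show "\<bar>r\<bar> \<le> lam"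
  proof (rule ccontr)
    assume "\<not> \<bar>r\<bar> \<le> lam"
    then consider "r > lam" | "r < - lam" by linarith
    then show False
    proof cases
      case 1
      then have "(r - lam)\<^sup>2 > 0" by simp
      then show False
        using min[of "r - lam"] 1 by (simp add: m power2_eq_square algebra_simps)
    next
      case 2
      then have "(r + lam)\<^sup>2 > 0" by simp
      then show False
        using min[of "r + lam"] 2 by (simp add: m power2_eq_square algebra_simps)
    qed
  qed
qed

lemma penalized_loss_minimizer_eq_0_iff:
  assumes "is_arg_min (penalized_loss n lam y x) (\<lambda>_. True) (m, b)" and "lam > 0" "i \<in> {1..n}"
  shows "m i = 0 \<longleftrightarrow> \<bar>y i - x i \<bullet> b\<bar> \<le> lam"
proof (rule soft_threshold_eq_0_iff[OF \<open>lam > 0\<close>])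
  fix t
  have "penalized_loss n lam y x (m, b) \<le> penalized_loss n lam y x (m(i := t), b)"
    using assms(1) by (auto simp: is_arg_min_def not_less)
  then show "(y i - x i \<bullet> b - m i)\<^sup>2 + 2 * lam * \<bar>m i\<bar> \<le> (y i - x i \<bullet> b - t)\<^sup>2 + 2 * lam * \<bar>t\<bar>"
    using penalized_loss_fun_upd[OF assms(3), of lam y x m t b] by linarith
qed

lemma min_signal_nonneg: "0 \<le> min_signal m k"
  unfolding min_signal_def by (rule INF_greatest) simp

text \<open>The truncated minimum lies between 0 and \<bar>m i\<bar>. It is therefore finite,
  \<open>real_of_ereal\<close> returns its true value instead of a default, and the outer absolute
  value changes nothing.\<close>

lemma min_signal_le_entry:
  assumes "i \<in> {1..k}" "0 \<le> B"
  shows "\<bar>real_of_ereal (min (min_signal m k) (ereal B))\<bar> \<le> \<bar>m i\<bar>"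
proof -
  have "min (min_signal m k) (ereal B) \<le> ereal \<bar>m i\<bar>"
    unfolding min_signal_def using assms(1) by (meson INF_lower min.coboundedI1)
  moreover have "0 \<le> min (min_signal m k) (ereal B)"
    using min_signal_nonneg assms(2) by simp
  ultimately show ?thesis
    by (cases "min (min_signal m k) (ereal B)") auto
qed

lemma iid_copies_measurable:
  assumes "prob_space M" "iid_copies M Z I M\<^sub>0 Z\<^sub>0" "i \<in> I"
  shows "Z i \<in> borel_measurable M"
  using assms by (simp add: iid_copies_def prob_space.indep_vars_def2)

lemma (in prob_space) prob_ge_if_three_exceptions:
  assumes sets: "A \<in> events" "B \<in> events" "C \<in> events" "E \<in> events"
    and cover: "space M - (A \<union> B \<union> C) \<subseteq> E"
  shows "prob E \<ge> 1 - prob A - prob B - prob C"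
proof -
  have "1 = prob (space M)" by (simp add: prob_space)
  also have "\<dots> \<le> prob (E \<union> (A \<union> B \<union> C))"
    using sets cover by (intro finite_measure_mono) auto
  also have "\<dots> \<le> prob E + prob (A \<union> B \<union> C)"
    using sets by (intro measure_Un_le) auto
  also have "prob (A \<union> B \<union> C) \<le> prob (A \<union> B) + prob C"
    using sets by (intro measure_Un_le) auto
  also have "prob (A \<union> B) \<le> prob A + prob B"
    using sets by (intro measure_Un_le) auto
  finally show ?thesis by linarith
qed

theorem theorem3p4:
  fixes M\<^sub>0 :: "'c measure" and X\<^sub>0 :: "'c \<Rightarrow> real ^ 'd" and \<epsilon>\<^sub>0 :: "'c \<Rightarrow> real" and \<sigma> :: real
    and M :: "nat \<Rightarrow> 'a measure"
    and X :: "nat \<Rightarrow> nat \<Rightarrow> 'a \<Rightarrow> real ^ 'd" and \<epsilon> Y :: "nat \<Rightarrow> nat \<Rightarrow> 'a \<Rightarrow> real"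
    and \<mu> :: "nat \<Rightarrow> nat \<Rightarrow> real" and \<beta> :: "real ^ 'd"
    and \<kappa> \<gamma> lam :: "nat \<Rightarrow> real" and \<alpha> :: real and s\<^sub>1 s\<^sub>2 :: "nat \<Rightarrow> nat"
    and \<mu>hat :: "nat \<Rightarrow> 'a \<Rightarrow> nat \<Rightarrow> real" and \<beta>hat :: "nat \<Rightarrow> 'a \<Rightarrow> real ^ 'd"
  \<comment> \<open>the random vector \<open>X\<^sub>0\<close> and the random variable \<open>\<epsilon>\<^sub>0\<close>\<close>
  assumes "prob_space M\<^sub>0"
    and "X\<^sub>0 \<in> borel_measurable M\<^sub>0" "integrable M\<^sub>0 (\<lambda>\<omega>. (norm (X\<^sub>0 \<omega>))\<^sup>2)"
    and "integrable M\<^sub>0 X\<^sub>0" "prob_space.expectation M\<^sub>0 X\<^sub>0 = 0"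
    and "positive_definite (covariance_matrix M\<^sub>0 X\<^sub>0)"
    and "\<epsilon>\<^sub>0 \<in> borel_measurable M\<^sub>0" "integrable M\<^sub>0 (\<lambda>\<omega>. (\<epsilon>\<^sub>0 \<omega>)\<^sup>2)"
    and "integrable M\<^sub>0 \<epsilon>\<^sub>0" "prob_space.expectation M\<^sub>0 \<epsilon>\<^sub>0 = 0"
    and "prob_space.variance M\<^sub>0 \<epsilon>\<^sub>0 = \<sigma>\<^sup>2" "\<sigma>\<^sup>2 > 0"
  \<comment> \<open>the model\<close>
    and "\<forall>n\<ge>1. prob_space (M n)"
    and "\<forall>n\<ge>1. iid_copies (M n) (X n) {1..n} M\<^sub>0 X\<^sub>0"
    and "\<forall>n\<ge>1. iid_copies (M n) (\<epsilon> n) {1..n} M\<^sub>0 \<epsilon>\<^sub>0"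
    and "\<forall>n\<ge>1. indep_families (M n) (X n) (\<epsilon> n) {1..n}"
    and "\<forall>n\<ge>1. \<forall>i\<in>{1..n}. \<forall>\<omega>\<in>space (M n). Y n i \<omega> = \<mu> n i + X n i \<omega> \<bullet> \<beta> + \<epsilon> n i \<omega>"
  \<comment> \<open>Assumption (A)\<close>
    and "\<forall>n\<ge>1. \<kappa> n > 0" "\<kappa> \<in> o(\<lambda>n. sqrt (real n))"
    and "\<forall>n\<ge>1. \<gamma> n > 0" "\<gamma> \<in> o(\<lambda>n. sqrt (real n))"
    and "(\<lambda>n. measure (M n) {\<omega> \<in> space (M n). (MAX i\<in>{1..n}. norm (X n i \<omega>)) > \<kappa> n}) \<longlonglongrightarrow> 0"
    and "(\<lambda>n. measure (M n) {\<omega> \<in> space (M n). (MAX i\<in>{1..n}. \<bar>\<epsilon> n i \<omega>\<bar>) > \<gamma> n}) \<longlonglongrightarrow> 0"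
  \<comment> \<open>the incidental parameters\<close>
    and "\<forall>n\<ge>1. s\<^sub>1 n + s\<^sub>2 n \<le> n" "(\<lambda>n. real (s\<^sub>1 n + s\<^sub>2 n)) \<in> o(\<lambda>n. real n)"
    and "dominated_by_entries (\<lambda>n. max (\<kappa> n) (\<gamma> n)) \<mu> s\<^sub>1"
    and "\<forall>n\<ge>1. \<forall>i\<in>{s\<^sub>1 n + 1..s\<^sub>1 n + s\<^sub>2 n}. 0 < \<bar>\<mu> n i\<bar> \<and> \<bar>\<mu> n i\<bar> \<le> \<gamma> n"
    and "\<forall>n\<ge>1. \<forall>i\<in>{s\<^sub>1 n + s\<^sub>2 n + 1..n}. \<mu> n i = 0"
  \<comment> \<open>Assumption (B)\<close>
    and "\<forall>n\<ge>1. lam n > 0" "\<kappa> \<in> o(lam)"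
    and "\<alpha> > 2" "\<forall>n\<ge>1. \<alpha> * \<gamma> n \<le> lam n"
    and "lam \<in> o(\<lambda>n. real_of_ereal (min (min_signal (\<mu> n) (s\<^sub>1 n)) (ereal (sqrt (real n)))))"
  \<comment> \<open>the estimators\<close>
    and "\<forall>n\<ge>1. \<forall>i\<in>{1..n}. (\<lambda>\<omega>. \<mu>hat n \<omega> i) \<in> borel_measurable (M n)"
    and "\<forall>n\<ge>1. \<beta>hat n \<in> borel_measurable (M n)"
    and "\<forall>n\<ge>1. \<forall>\<omega>\<in>space (M n).
           is_arg_min (penalized_loss n (lam n) (\<lambda>i. Y n i \<omega>) (\<lambda>i. X n i \<omega>)) (\<lambda>_. True)
             (\<mu>hat n \<omega>, \<beta>hat n \<omega>)"
    and "converges_in_probability M \<beta>hat \<beta>"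
  shows "(\<lambda>n. measure (M n) {\<omega> \<in> space (M n).
            (\<forall>i\<in>{1..s\<^sub>1 n}. \<mu>hat n \<omega> i \<noteq> 0) \<and> (\<forall>i\<in>{s\<^sub>1 n + 1..n}. \<mu>hat n \<omega> i = 0)}) \<longlonglongrightarrow> 1"
proof -
  define A where "A n = {\<omega> \<in> space (M n). (MAX i\<in>{1..n}. norm (X n i \<omega>)) > \<kappa> n}" for n
  define B where "B n = {\<omega> \<in> space (M n). (MAX i\<in>{1..n}. \<bar>\<epsilon> n i \<omega>\<bar>) > \<gamma> n}" for n
  \<comment> \<open>Off this event, Cauchy-Schwarz bounds the effect of the estimation error on a
    residual by the norm of \<open>X n i \<omega>\<close> alone.\<close>
  define C where "C n = {\<omega> \<in> space (M n). dist (\<beta>hat n \<omega>) \<beta> > 1}" for n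
  define E where "E n = {\<omega> \<in> space (M n).
            (\<forall>i\<in>{1..s\<^sub>1 n}. \<mu>hat n \<omega> i \<noteq> 0) \<and> (\<forall>i\<in>{s\<^sub>1 n + 1..n}. \<mu>hat n \<omega> i = 0)}" for n
  \<comment> \<open>The constant is positive as \<alpha> > 2. The entry 1 serves the large
    parameters; the entry \<open>1 - 2 / \<alpha>\<close> leaves room for 2 \<gamma> \<le> 2 lam /
    \<alpha> at the others.\<close>
  have \<kappa>_lam: "\<forall>\<^sub>F n in sequentially. \<bar>\<kappa> n\<bar> \<le> min 1 (1 - 2 / \<alpha>) * \<bar>lam n\<bar>"
    using landau_o.smallD[OF assms(30), of "min 1 (1 - 2 / \<alpha>)"] assms(31) by simp
  \<comment> \<open>The factor 1/4 gives \<bar>r i\<bar> \<ge> 4 lam - \<kappa> - \<gamma> \<ge> 2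
    lam > lam at the large parameters.\<close>
  have lam_\<mu>: "\<forall>\<^sub>F n in sequentially. \<bar>lam n\<bar> \<le>
      1 / 4 * \<bar>real_of_ereal (min (min_signal (\<mu> n) (s\<^sub>1 n)) (ereal (sqrt (real n))))\<bar>"
    using landau_o.smallD[OF assms(33), of "1 / 4"] by simp
  have lower: "\<forall>\<^sub>F n in sequentially.
      1 - measure (M n) (A n) - measure (M n) (B n) - measure (M n) (C n) \<le> measure (M n) (E n)"
    using \<kappa>_lam lam_\<mu> eventually_ge_at_top[of 1]
  proof eventually_elim
    case (elim n)
    interpret prob_space "M n" using assms(13) elim by simp
    have X_meas [measurable]: "X n i \<in> borel_measurable (M n)" if "i \<in> {1..n}" for i
      using assms(14) elim(3) that prob_space_axioms by (blast intro: iid_copies_measurable)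
    have \<epsilon>_meas [measurable]: "\<epsilon> n i \<in> borel_measurable (M n)" if "i \<in> {1..n}" for i
      using assms(15) elim(3) that prob_space_axioms by (blast intro: iid_copies_measurable)
    have \<mu>hat_meas: "(\<lambda>\<omega>. \<mu>hat n \<omega> i) \<in> borel_measurable (M n)" if "i \<in> {1..n}" for i
      using assms(34) elim that by auto
    have [measurable]: "\<beta>hat n \<in> borel_measurable (M n)"
      using assms(35) elim by auto
    have "s\<^sub>1 n \<le> n" using assms(24) elim by (meson add_leD1)
    have "0 < \<kappa> n" "0 < \<gamma> n" "0 < lam n"
      using assms(18,20,29) elim by auto
    have \<gamma>_lam: "\<gamma> n \<le> lam n / \<alpha>"
      using assms(31,32) elim by (simp add: field_simps)
    show ?case
    proof (rule prob_ge_if_three_exceptions)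
      show "A n \<in> events"
        unfolding A_def using elim by measurable
      show "B n \<in> events"
        unfolding B_def using elim by measurable
      show "C n \<in> events"
        unfolding C_def by measurable
      show "E n \<in> events"
      proof -
        have [measurable]: "(\<lambda>\<omega>. \<mu>hat n \<omega> i) \<in> borel_measurable (M n)"
          if "i \<in> {1..s\<^sub>1 n} \<or> i \<in> {s\<^sub>1 n + 1..n}" for i
          using \<mu>hat_meas that \<open>s\<^sub>1 n \<le> n\<close> by auto
        show ?thesis unfolding E_def by measurable
      qed
      show "space (M n) - (A n \<union> B n \<union> C n) \<subseteq> E n"
      proof
        fix \<omega> assume \<omega>: "\<omega> \<in> space (M n) - (A n \<union> B n \<union> C n)"
        define r where "r i = Y n i \<omega> - X n i \<omega> \<bullet> \<beta>hat n \<omega>" for i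
        have iff: "\<mu>hat n \<omega> i = 0 \<longleftrightarrow> \<bar>r i\<bar> \<le> lam n" if "i \<in> {1..n}" for i
          unfolding r_def using assms(36) elim \<omega> \<open>0 < lam n\<close> that
          by (intro penalized_loss_minimizer_eq_0_iff) auto
        \<comment> \<open>The residual differs from its parameter by estimation error plus noise;
          this one bound serves both index ranges.\<close>
        have dev: "\<bar>r i - \<mu> n i\<bar> \<le> \<kappa> n + \<gamma> n" if i: "i \<in> {1..n}" for i
        proof -
          have "norm (X n i \<omega>) \<le> (MAX i\<in>{1..n}. norm (X n i \<omega>))"
            using i by (intro Max_ge) auto
          then have X: "norm (X n i \<omega>) \<le> \<kappa> n"
            using \<omega> by (auto simp: A_def)
          have "\<bar>\<epsilon> n i \<omega>\<bar> \<le> (MAX i\<in>{1..n}. \<bar>\<epsilon> n i \<omega>\<bar>)"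
            using i by (intro Max_ge) auto
          then have \<epsilon>: "\<bar>\<epsilon> n i \<omega>\<bar> \<le> \<gamma> n"
            using \<omega> by (auto simp: B_def)
          have "norm (\<beta> - \<beta>hat n \<omega>) \<le> 1"
            using \<omega> by (auto simp: C_def dist_norm norm_minus_commute)
          then have "norm (X n i \<omega>) * norm (\<beta> - \<beta>hat n \<omega>) \<le> \<kappa> n * 1"
            using X \<open>0 < \<kappa> n\<close> by (intro mult_mono) auto
          then have "\<bar>X n i \<omega> \<bullet> (\<beta> - \<beta>hat n \<omega>)\<bar> \<le> \<kappa> n"
            using Cauchy_Schwarz_ineq2[of "X n i \<omega>" "\<beta> - \<beta>hat n \<omega>"] by linarith
          moreover have "r i - \<mu> n i = X n i \<omega> \<bullet> (\<beta> - \<beta>hat n \<omega>) + \<epsilon> n i \<omega>"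
            using assms(17) elim \<omega> i by (simp add: r_def inner_diff_right)
          ultimately show ?thesis
            using \<epsilon> by linarith
        qed
        have "\<mu>hat n \<omega> i \<noteq> 0" if i: "i \<in> {1..s\<^sub>1 n}" for i
        proof -
          have "4 * lam n \<le> \<bar>\<mu> n i\<bar>"
            using elim(2) min_signal_le_entry[OF i, of "sqrt (real n)" "\<mu> n"] \<open>0 < lam n\<close> by simp
          moreover have "\<kappa> n \<le> lam n"
          proof -
            have "min 1 (1 - 2 / \<alpha>) * \<bar>lam n\<bar> \<le> 1 * \<bar>lam n\<bar>"
              by (intro mult_right_mono) auto
            then show ?thesis using elim(1) \<open>0 < lam n\<close> by linarith
          qed
          moreover have "lam n / \<alpha> \<le> lam n"
            using \<open>0 < lam n\<close> assms(31) by (simp add: field_simps)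
          ultimately have "\<bar>r i\<bar> > lam n"
            using dev[of i] \<gamma>_lam i \<open>s\<^sub>1 n \<le> n\<close> \<open>0 < lam n\<close> by auto
          then show ?thesis
            using iff[of i] i \<open>s\<^sub>1 n \<le> n\<close> by auto
        qed
        moreover have "\<mu>hat n \<omega> i = 0" if i: "i \<in> {s\<^sub>1 n + 1..n}" for i
        proof -
          \<comment> \<open>Small and zero parameters are merged here: either way \<bar>r i\<bar>
            \<le> \<kappa> + 2 \<gamma>.\<close>
          have "\<bar>\<mu> n i\<bar> \<le> \<gamma> n"
          proof (cases "i \<le> s\<^sub>1 n + s\<^sub>2 n")
            case True
            then show ?thesis using assms(27) elim i by auto
          next
            case False
            then show ?thesis using assms(28) elim i \<open>0 < \<gamma> n\<close> by auto
          qed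
          moreover have "\<kappa> n \<le> lam n - 2 * (lam n / \<alpha>)"
          proof -
            have "min 1 (1 - 2 / \<alpha>) * \<bar>lam n\<bar> \<le> (1 - 2 / \<alpha>) * \<bar>lam n\<bar>"
              by (intro mult_right_mono) auto
            then show ?thesis
              using elim(1) \<open>0 < lam n\<close> by (simp add: algebra_simps)
          qed
          ultimately have "\<bar>r i\<bar> \<le> lam n"
            using dev[of i] \<gamma>_lam i by auto
          then show ?thesis
            using iff[of i] i by auto
        qed
        ultimately show "\<omega> \<in> E n"
          using \<omega> by (auto simp: E_def)
      qed
    qed
  qed
  \<comment> \<open>\<open>M 0\<close> may be any measure, so even this bound is claimed only
    eventually.\<close>
  have upper: "\<forall>\<^sub>F n in sequentially. measure (M n) (E n) \<le> 1"
    using eventually_ge_at_top[of 1]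
    by eventually_elim (use assms(13) in \<open>auto intro: prob_space.prob_le_1\<close>)
  have "(\<lambda>n. measure (M n) (C n)) \<longlonglongrightarrow> 0"
    using assms(37) by (auto simp: C_def converges_in_probability_def)
  then have "(\<lambda>n. 1 - measure (M n) (A n) - measure (M n) (B n) - measure (M n) (C n))
      \<longlonglongrightarrow> 1 - 0 - 0 - 0"
    using assms(22,23) unfolding A_def B_def by (intro tendsto_diff tendsto_const)
  then have "(\<lambda>n. measure (M n) (E n)) \<longlonglongrightarrow> 1"
    using tendsto_sandwich[OF lower upper _ tendsto_const] by simp
  then show ?thesis
    by (simp add: E_def)
qed

end
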